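(* Let $a>0$ and suppose that $$P\{\eta_1 > a(1-\lambda)\} > 0$$ and that for some $\delta\in(0,1)$ $$E(\eta_1^-)^\delta < \infty .$$ Then there exists $\alpha>0$ such that $$E e^{\alpha\tau_a} < \infty .$$
   Context: Let $\{\eta_n\}_{n\ge 1}$ be a sequence of independent identically distributed real random variables, and let $\lambda$ and $x$ be nonrandom real constants with $0<\lambda<1$. The AR(1) sequence $(X_n)_{n\ge 0}$ is defined by $X_0=x$ and $X_n=\lambda X_{n-1}+\eta_n$ for $n=1,2,\dots$. For a real number $a\ge x$, the first passage time is $\tau_a=\inf\{n\ge 0: X_n>a\}$, with $\inf\emptyset=\infty$. Notation: $y^-=\max(-y,0)$. *)

theory Defs
  imports "HOL-Probability.Probability"
begin

text \<open>The innovations are indexed from 1; the value of \<open>\<eta>\<close> at index 0 is never used.\<close>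

primrec ar1 :: "real \<Rightarrow> real \<Rightarrow> (nat \<Rightarrow> 'a \<Rightarrow> real) \<Rightarrow> nat \<Rightarrow> 'a \<Rightarrow> real" where
  "ar1 lam x \<eta> 0 \<omega> = x"
| "ar1 lam x \<eta> (Suc n) \<omega> = lam * ar1 lam x \<eta> n \<omega> + \<eta> (Suc n) \<omega>"

text \<open>The infimum is taken in \<^typ>\<open>enat\<close>, so it is \<open>\<infinity>\<close> if the level is never exceeded.\<close>

definition first_passage :: "(nat \<Rightarrow> 'a \<Rightarrow> real) \<Rightarrow> real \<Rightarrow> 'a \<Rightarrow> enat" where
  "first_passage X a \<omega> = Inf {enat n | n. X n \<omega> > a}"

text \<open>\<open>e\<^sup>\<alpha>\<^sup>t\<close> for an extended time \<open>t\<close>; the value \<open>\<infinity>\<close> at \<open>t = \<infinity>\<close> is the convention for \<open>\<alpha> > 0\<close>,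
  the only case in which the function is used.\<close>

definition exp_time :: "real \<Rightarrow> enat \<Rightarrow> ennreal" where
  "exp_time \<alpha> t = (case t of enat n \<Rightarrow> ennreal (exp (\<alpha> * real n)) | \<infinity> \<Rightarrow> \<infinity>)"

definition neg_part :: "real \<Rightarrow> real" where
  "neg_part y = max (- y) 0"

end

theory Submission
  imports Defs
begin

text \<open>
  The proof is a Foster--Lyapunov argument.  Write \<open>Y\<^sub>n = a - X\<^sub>n\<close> for the distance below the level and
  \<open>\<mu>\<close> for the law of the innovations.  The key is a function \<open>v \<ge> 1\<close> of the state below the level
  whose mean after one step, counted only if the level is still not exceeded, is at most
  \<open>\<rho> v\<close> with a constant \<open>\<rho> < 1\<close> (\<open>lyapunov_function\<close>).  Two effects produce the contraction.
  Far below the level, \<open>Y\<close> is multiplied by \<open>lam < 1\<close>, so \<open>Y\<^sup>\<delta>\<close> contracts by the factor \<open>lam\<^sup>\<delta>\<close>, up to an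
  additive constant that is finite by the moment assumption.  Near the level, an innovation above
  \<open>a (1 - lam) + \<epsilon>\<close>, which has a positive probability, decreases \<open>Y\<close> by at least \<open>\<epsilon>\<close> or leads to
  an exit; the bounded increasing function \<open>1 - (p / 2) e\<^sup>-\<^sup>\<beta>\<^sup>Y\<close> turns this into a strict decrease in
  mean.  A sum of the two functions, with a small weight on the power, works for all \<open>Y \<ge> 0\<close>.

  The autoregression frozen at its first value above \<open>a\<close> is a random recursion whose next innovation
  is independent of the current state.  With \<open>v\<close> set to zero above the level, the drift inequality
  therefore iterates to \<open>P(\<tau>\<^sub>a > n) \<le> v(x) \<rho>\<^sup>n\<close> (\<open>recursion_geometric_drift\<close>), and
  a geometric tail gives a finite exponential moment (\<open>exp_moment_of_geometric_tail\<close>).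
\<close>

section \<open>Subadditivity of powers\<close>

lemma powr_add_le:
  fixes x y d :: real
  assumes "0 \<le> x" "0 \<le> y" "0 < d" "d \<le> 1"
  shows "(x + y) powr d \<le> x powr d + y powr d"
proof (cases "x + y = 0")
  case True
  with assms show ?thesis by simp
next
  case False
  define s where "s = x + y"
  have s: "0 < s" using False assms by (simp add: s_def)
  have le: "t \<le> t powr d" if "0 \<le> t" "t \<le> 1" for t
    using powr_mono'[of d 1 t] that assms by simp
  have "1 = x / s + y / s" using s by (simp add: s_def add_divide_distrib[symmetric])
  also have "\<dots> \<le> (x / s) powr d + (y / s) powr d"
    using assms s by (intro add_mono le) (auto simp: s_def)
  also have "\<dots> = (x powr d + y powr d) / s powr d"
    using assms s by (simp add: powr_divide add_divide_distrib)
  finally show ?thesis using s by (simp add: s_def field_simps)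
qed

section \<open>A Lyapunov function\<close>

lemma positive_prob_above_shift:
  fixes c :: real
  assumes "prob_space \<mu>" and [measurable_cong]: "sets \<mu> = sets borel"
    and "measure \<mu> {c<..} > 0"
  shows "\<exists>\<epsilon>>0. measure \<mu> {c + \<epsilon>..} > 0"
proof (rule ccontr)
  interpret prob_space \<mu> by fact
  assume *: "\<not> ?thesis"
  have "measure \<mu> {c + 1 / real (Suc n)..} = 0" for n
  proof -
    have "\<not> measure \<mu> {c + 1 / real (Suc n)..} > 0"
      using * by (metis zero_less_divide_1_iff of_nat_0_less_iff zero_less_Suc)
    then show ?thesis by (simp add: zero_less_measure_iff)
  qed
  then have "{c + 1 / real (Suc n)..} \<in> null_sets \<mu>" for n
    by (auto simp: null_sets_def emeasure_eq_measure assms(2))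
  then have "(\<Union>n. {c + 1 / real (Suc n)..}) \<in> null_sets \<mu>" by blast
  moreover have "{c<..} \<subseteq> (\<Union>n. {c + 1 / real (Suc n)..})"
  proof
    fix y assume "y \<in> {c<..}"
    then obtain n where "1 / real (Suc n) < y - c"
      using nat_approx_posE[of "y - c"] by auto
    then show "y \<in> (\<Union>n. {c + 1 / real (Suc n)..})" by (auto intro!: exI[of _ n])
  qed
  ultimately have "{c<..} \<in> null_sets \<mu>"
    using null_sets_subset[of "\<Union>n. {c + 1 / real (Suc n)..}" \<mu> "{c<..}"] by (simp add: assms(2))
  then show False using assms(3) by (simp add: null_sets_def emeasure_eq_measure)
qed

lemma neg_part_nonneg [simp]: "0 \<le> neg_part y"
  by (simp add: neg_part_def)

lemma neg_part_measurable [measurable]: "neg_part \<in> borel_measurable borel"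
  unfolding neg_part_def by measurable

text \<open>
  With \<open>y = a - z\<close> the distance to the level, \<open>p = \<mu> {a (1 - lam) + \<epsilon>..} > 0\<close> and \<open>\<beta>\<close> chosen
  such that \<open>e\<^sup>\<beta>\<^sup>\<epsilon> = 2 / p\<close>, the function is \<open>2 w(y)\<close>, where \<open>w(y) = 1 - s(y) + \<kappa> y\<^sup>\<delta>\<close> and
  \<open>s(y) = (p / 2) e\<^sup>-\<^sup>\<beta>\<^sup>y\<close>.  Since \<open>s(y - \<epsilon>) = e\<^sup>-\<^sup>\<beta>\<^sup>y \<le> 1\<close>, a large innovation leaves at
  most \<open>1 - e\<^sup>-\<^sup>\<beta>\<^sup>y\<close> of the term \<open>1 - s\<close>, whether or not the level is passed.  As this has
  probability \<open>p\<close>, the mean of this term after one step is at most \<open>1 - 2 s(y)\<close>, a gain of \<open>s(y)\<close>.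
\<close>

lemma lyapunov_function:
  fixes \<mu> :: "real measure" and lam a \<delta> :: real
  assumes "prob_space \<mu>" and sets [measurable_cong]: "sets \<mu> = sets borel"
    and lam: "0 < lam" "lam < 1" and "0 < a"
    and pos: "measure \<mu> {a * (1 - lam)<..} > 0"
    and \<delta>: "0 < \<delta>" "\<delta> < 1"
    and int: "integrable \<mu> (\<lambda>e. neg_part e powr \<delta>)"
  obtains v :: "real \<Rightarrow> real" and \<rho> :: real
  where "v \<in> borel_measurable borel" "0 < \<rho>" "\<rho> < 1" "\<And>z. z \<le> a \<Longrightarrow> 1 \<le> v z"
    "\<And>z. z \<le> a \<Longrightarrow>
       (\<integral>\<^sup>+e. ennreal (if lam * z + e \<le> a then v (lam * z + e) else 0) \<partial>\<mu>) \<le> ennreal (\<rho> * v z)"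
proof -
  interpret prob_space \<mu> by fact
  define c where "c = a * (1 - lam)"
  have c: "0 < c" using lam \<open>0 < a\<close> by (simp add: c_def)
  obtain \<epsilon> where \<epsilon>: "0 < \<epsilon>" and pos': "measure \<mu> {c + \<epsilon>..} > 0"
    using positive_prob_above_shift[of \<mu> c] pos \<open>prob_space \<mu>\<close> sets by (auto simp: c_def)
  define p where "p = measure \<mu> {c + \<epsilon>..}"
  have p: "0 < p" "p \<le> 1" using pos' by (auto simp: p_def)
  define \<beta> where "\<beta> = ln (2 / p) / \<epsilon>"
  have \<beta>: "0 < \<beta>" using p \<epsilon> by (simp add: \<beta>_def)
  have exp_\<beta>: "exp (\<beta> * \<epsilon>) = 2 / p" using p \<epsilon> by (simp add: \<beta>_def)
  define m where "m = (\<integral>e. neg_part e powr \<delta> \<partial>\<mu>) + c powr \<delta>"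
  have m: "0 \<le> m" by (auto simp: m_def intro!: add_nonneg_nonneg integral_nonneg)
  define s where "s y = p / 2 * exp (- \<beta> * y)" for y
  have s_anti: "s y' \<le> s y" if "y \<le> y'" for y y'
    using that p \<beta> by (simp add: s_def)
  have s_pos: "0 < s y" for y using p by (simp add: s_def)
  have s_shift: "s (y - \<epsilon>) = exp (- \<beta> * y)" for y
  proof -
    have "exp (- \<beta> * (y - \<epsilon>)) = exp (- \<beta> * y) * exp (\<beta> * \<epsilon>)"
      by (simp add: exp_add[symmetric] algebra_simps)
    then show ?thesis using p by (simp add: s_def exp_\<beta>)
  qed
  define l where "l = lam powr \<delta>"
  have l: "0 < l" "l < 1" using lam \<delta> powr_less_mono2[of \<delta> lam 1] by (auto simp: l_def)
  define g where "g = (1 - l) / 2"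
  have g: "0 < g" using l by (simp add: g_def)
  \<comment> \<open>Beyond \<open>y0\<close> the contraction of the power compensates its additive constant for every weight
    \<open>\<kappa>\<close>; up to \<open>y0\<close> the gain \<open>s y \<ge> s y0\<close> has to do so, which fixes \<open>\<kappa>\<close>.\<close>
  define y0 where "y0 = ((1 + m) / g) powr (1 / \<delta>)"
  define \<kappa> where "\<kappa> = s y0 / (1 + m)"
  have \<kappa>: "0 < \<kappa>" using s_pos m by (simp add: \<kappa>_def)
  define \<rho> where "\<rho> = max ((1 + l) / 2) (1 - \<kappa>)"
  have \<rho>: "0 < \<rho>" "\<rho> < 1" "g \<le> \<rho> - l" "1 - \<rho> \<le> \<kappa>"
    using l \<kappa> by (auto simp: \<rho>_def g_def field_simps less_max_iff_disj)
  define w where "w y = 1 - s y + \<kappa> * y powr \<delta>" for y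

  have drift: "1 - 2 * s y + \<kappa> * (l * y powr \<delta> + m) \<le> \<rho> * w y" if y: "0 \<le> y" for y
  proof -
    have key: "\<kappa> * (1 + m) \<le> s y + \<kappa> * g * y powr \<delta>"
    proof (cases "y \<le> y0")
      case True
      have "\<kappa> * (1 + m) = s y0" using m by (simp add: \<kappa>_def)
      also have "\<dots> \<le> s y" by (rule s_anti) fact
      finally show ?thesis using \<kappa> g by (simp add: add_increasing2)
    next
      case False
      have "(1 + m) / g = y0 powr \<delta>"
        using m g \<delta> by (simp add: y0_def powr_powr)
      also have "\<dots> \<le> y powr \<delta>"
        using False \<delta> by (intro powr_mono2) (auto simp: y0_def)
      finally have "1 + m \<le> g * y powr \<delta>" using g by (simp add: field_simps)
      then have "\<kappa> * (1 + m) \<le> \<kappa> * (g * y powr \<delta>)" using \<kappa> by (intro mult_left_mono) auto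
      then show ?thesis using s_pos[of y] by (simp add: mult.assoc)
    qed
    have "\<kappa> * g * y powr \<delta> \<le> \<kappa> * (\<rho> - l) * y powr \<delta>"
      using \<rho> \<kappa> by (intro mult_right_mono mult_left_mono) auto
    moreover have "0 \<le> (1 - \<rho>) * s y" using \<rho> s_pos[of y] by simp
    ultimately show ?thesis
      using key \<rho>(4) by (simp add: w_def algebra_simps)
  qed

  have w_ge: "1 / 2 \<le> w y" if y: "0 \<le> y" for y
  proof -
    have "s y \<le> s 0" using y by (rule s_anti)
    also have "s 0 \<le> 1 / 2" using p by (simp add: s_def)
    finally show ?thesis using \<kappa> by (simp add: w_def add_increasing2)
  qed

  define v where "v z = 2 * w (a - z)" for z
  show ?thesis
  proof
    show "v \<in> borel_measurable borel" unfolding v_def w_def s_def by measurable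
    show "0 < \<rho>" "\<rho> < 1" by fact+
    show "1 \<le> v z" if "z \<le> a" for z using w_ge[of "a - z"] that by (simp add: v_def)
    show "(\<integral>\<^sup>+e. ennreal (if lam * z + e \<le> a then v (lam * z + e) else 0) \<partial>\<mu>) \<le> ennreal (\<rho> * v z)"
      if z: "z \<le> a" for z
    proof -
      define y where "y = a - z"
      have y: "0 \<le> y" using z by (simp add: y_def)
      \<comment> \<open>A pointwise bound of the integrand by a function with a computable mean.\<close>
      define B where
        "B e = 2 * (1 - exp (- \<beta> * y) * indicator {c + \<epsilon>..} e
                 + \<kappa> * (l * y powr \<delta> + (neg_part e powr \<delta> + c powr \<delta>)))" for e
      have exp_le: "exp (- \<beta> * y) \<le> 1" using \<beta> y by simp
      have bound: "(if lam * z + e \<le> a then v (lam * z + e) else 0) \<le> B e" for e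
      proof (cases "lam * z + e \<le> a")
        case False
        have "0 \<le> 1 - exp (- \<beta> * y) * indicator {c + \<epsilon>..} e"
          using exp_le by (auto simp: indicator_def)
        then have "0 \<le> B e"
          using \<kappa> l unfolding B_def by (intro mult_nonneg_nonneg add_nonneg_nonneg) auto
        with False show ?thesis by simp
      next
        case True
        define y' where "y' = a - (lam * z + e)"
        have y': "0 \<le> y'" using True by (simp add: y'_def)
        \<comment> \<open>In terms of distances to the level, one step is \<open>y \<mapsto> lam y - (e - c)\<close>.\<close>
        have y'_eq: "y' = lam * y + (c - e)" by (simp add: y'_def y_def c_def algebra_simps)
        have "y' \<le> lam * y + (neg_part e + c)" by (simp add: y'_eq neg_part_def)
        then have "y' powr \<delta> \<le> (lam * y + (neg_part e + c)) powr \<delta>"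
          using y' \<delta> by (intro powr_mono2) auto
        also have "\<dots> \<le> (lam * y) powr \<delta> + (neg_part e + c) powr \<delta>"
          using lam y c \<delta> by (intro powr_add_le) auto
        also have "\<dots> \<le> (lam * y) powr \<delta> + (neg_part e powr \<delta> + c powr \<delta>)"
          using c \<delta> by (intro add_left_mono powr_add_le) auto
        also have "(lam * y) powr \<delta> = l * y powr \<delta>"
          using lam y by (simp add: powr_mult l_def)
        finally have "\<kappa> * y' powr \<delta> \<le> \<kappa> * (l * y powr \<delta> + (neg_part e powr \<delta> + c powr \<delta>))"
          using \<kappa> by (intro mult_left_mono) auto
        moreover have "exp (- \<beta> * y) * indicator {c + \<epsilon>..} e \<le> s y'"
        proof (cases "c + \<epsilon> \<le> e")
          case True
          have "lam * y \<le> y" using lam y by (simp add: mult_left_le_one_le)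
          with True have "y' \<le> y - \<epsilon>" by (simp add: y'_eq)
          then have "s (y - \<epsilon>) \<le> s y'" by (rule s_anti)
          with True show ?thesis unfolding s_shift by simp
        next
          case False
          then show ?thesis using s_pos[of y'] by simp
        qed
        ultimately have "w y' \<le> B e / 2" by (simp add: w_def B_def)
        then show ?thesis using True by (simp add: v_def y'_def)
      qed
      have int_ind: "integrable \<mu> (indicator {c + \<epsilon>..} :: real \<Rightarrow> real)"
        by (rule integrable_real_indicator) (auto simp: sets emeasure_eq_measure)
      then have int_B: "integrable \<mu> B"
        unfolding B_def using int
        by (intro integrable_mult_right Bochner_Integration.integrable_add
            Bochner_Integration.integrable_diff integrable_const)
      have B_nonneg: "0 \<le> B e" for e
      proof -
        have "0 \<le> (if lam * z + e \<le> a then v (lam * z + e) else 0)"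
          using w_ge[of "a - (lam * z + e)"] by (auto simp: v_def)
        then show ?thesis using bound[of e] by linarith
      qed
      have "(\<integral>\<^sup>+e. ennreal (if lam * z + e \<le> a then v (lam * z + e) else 0) \<partial>\<mu>) \<le> (\<integral>\<^sup>+e. ennreal (B e) \<partial>\<mu>)"
        by (intro nn_integral_mono ennreal_leI bound)
      also have "\<dots> = ennreal (\<integral>e. B e \<partial>\<mu>)"
        using int_B B_nonneg by (intro nn_integral_eq_integral) auto
      also have "(\<integral>e. B e \<partial>\<mu>) = 2 * (1 - exp (- \<beta> * y) * p + \<kappa> * (l * y powr \<delta> + m))"
      proof -
        have "has_bochner_integral \<mu> (indicator {c + \<epsilon>..}) p"
          using int_ind by (simp add: has_bochner_integral_iff p_def sets)
        moreover have "has_bochner_integral \<mu> (\<lambda>e. k) k" for k :: real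
          using prob_space by (simp add: has_bochner_integral_iff)
        moreover have "has_bochner_integral \<mu> (\<lambda>e. neg_part e powr \<delta>) (m - c powr \<delta>)"
          using int by (simp add: has_bochner_integral_iff m_def)
        ultimately have "has_bochner_integral \<mu> B (2 * (1 - exp (- \<beta> * y) * p
            + \<kappa> * (l * y powr \<delta> + ((m - c powr \<delta>) + c powr \<delta>))))"
          unfolding B_def
          by (intro has_bochner_integral_mult_right has_bochner_integral_add
              has_bochner_integral_diff)
        then show ?thesis by (simp add: has_bochner_integral_iff)
      qed
      also have "exp (- \<beta> * y) * p = 2 * s y" by (simp add: s_def)
      also have "2 * (1 - 2 * s y + \<kappa> * (l * y powr \<delta> + m)) \<le> \<rho> * v z"
        using drift[OF y] by (simp add: v_def y_def)
      finally show ?thesis by (simp add: ennreal_leI)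
    qed
  qed
qed

section \<open>Random recursions with independent innovations\<close>

text \<open>The state at time \<open>n\<close> of the recursion with update map \<open>f\<close>, started at \<open>z\<close> and driven by the
  inputs \<open>e 1, e 2, \<dots>\<close>.\<close>

primrec recursion :: "(real \<Rightarrow> real \<Rightarrow> real) \<Rightarrow> real \<Rightarrow> (nat \<Rightarrow> real) \<Rightarrow> nat \<Rightarrow> real" where
  "recursion f z e 0 = z"
| "recursion f z e (Suc n) = f (recursion f z e n) (e (Suc n))"

lemma recursion_cong:
  assumes "\<And>i. i \<in> {1..n} \<Longrightarrow> e i = e' i"
  shows "recursion f z e n = recursion f z e' n"
  using assms by (induction n) auto

lemma recursion_measurable:
  assumes [measurable]: "(\<lambda>(z, e). f z e) \<in> borel_measurable (borel \<Otimes>\<^sub>M borel)"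
    and "{1..n} \<subseteq> I"
  shows "(\<lambda>e. recursion f z e n) \<in> borel_measurable (PiM I (\<lambda>_. borel))"
  using assms(2)
proof (induction n)
  case (Suc n)
  then have [measurable]: "(\<lambda>e. recursion f z e n) \<in> borel_measurable (PiM I (\<lambda>_. borel))"
    by (intro Suc.IH order_trans[OF _ Suc.prems]) auto
  have "Suc n \<in> I" using Suc.prems by auto
  then have [measurable]: "(\<lambda>e. e (Suc n)) \<in> borel_measurable (PiM I (\<lambda>_. borel :: real measure))"
    by (rule measurable_component_singleton)
  have "(\<lambda>e. (\<lambda>(z, e). f z e) (recursion f z e n, e (Suc n))) \<in> borel_measurable (PiM I (\<lambda>_. borel))"
    by measurable
  then show ?case by simp
qed simp

lemma (in prob_space) recursion_random_variable:
  assumes indep: "indep_vars (\<lambda>_. borel) \<eta> {1..}"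
    and f: "(\<lambda>(z, e). f z e) \<in> borel_measurable (borel \<Otimes>\<^sub>M borel)"
  shows "random_variable borel (\<lambda>\<omega>. recursion f z (\<lambda>i. \<eta> i \<omega>) n)"
proof -
  have [measurable]: "random_variable borel (\<eta> i)" if "i \<in> {1..}" for i
    using indep_vars_def[of "\<lambda>_. borel" \<eta> "{1..}"] indep that by auto
  have "(\<lambda>\<omega>. recursion f z (\<lambda>i\<in>{1..n}. \<eta> i \<omega>) n) \<in> borel_measurable M"
    by (rule measurable_compose[OF measurable_restrict recursion_measurable[OF f order_refl]]) auto
  also have "(\<lambda>\<omega>. recursion f z (\<lambda>i\<in>{1..n}. \<eta> i \<omega>) n) = (\<lambda>\<omega>. recursion f z (\<lambda>i. \<eta> i \<omega>) n)"
    by (intro ext recursion_cong) auto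
  finally show ?thesis .
qed

lemma (in prob_space) recursion_indep_next:
  assumes indep: "indep_vars (\<lambda>_. borel) \<eta> {1..}"
    and f: "(\<lambda>(z, e). f z e) \<in> borel_measurable (borel \<Otimes>\<^sub>M borel)"
  shows "indep_var borel (\<lambda>\<omega>. recursion f z (\<lambda>i. \<eta> i \<omega>) n) borel (\<eta> (Suc n))"
proof -
  have "indep_var borel ((\<lambda>e. recursion f z e n) \<circ> (\<lambda>\<omega>. \<lambda>i\<in>{1..n}. \<eta> i \<omega>))
          borel ((\<lambda>e. e (Suc n)) \<circ> (\<lambda>\<omega>. \<lambda>i\<in>{Suc n}. \<eta> i \<omega>))"
    by (intro indep_var_compose[OF indep_var_restrict[OF indep]] recursion_measurable[OF f]
        measurable_component_singleton) auto
  also have "(\<lambda>e. recursion f z e n) \<circ> (\<lambda>\<omega>. \<lambda>i\<in>{1..n}. \<eta> i \<omega>) = (\<lambda>\<omega>. recursion f z (\<lambda>i. \<eta> i \<omega>) n)"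
    unfolding comp_def by (intro ext recursion_cong) auto
  also have "(\<lambda>e. e (Suc n)) \<circ> (\<lambda>\<omega>. \<lambda>i\<in>{Suc n}. \<eta> i \<omega>) = \<eta> (Suc n)"
    by auto
  finally show ?thesis .
qed

text \<open>A one-step contraction of \<open>v\<close> in mean under the common law of the innovations gives geometric
  decay along the whole recursion.\<close>

lemma (in prob_space) recursion_geometric_drift:
  fixes v :: "real \<Rightarrow> ennreal" and r :: ennreal
  assumes indep: "indep_vars (\<lambda>_. borel) \<eta> {1..}"
    and ident: "\<And>n. n \<ge> 1 \<Longrightarrow> distr M borel (\<eta> n) = \<mu>"
    and f [measurable]: "(\<lambda>(z, e). f z e) \<in> borel_measurable (borel \<Otimes>\<^sub>M borel)"
    and v [measurable]: "v \<in> borel_measurable borel"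
    and drift: "\<And>z. (\<integral>\<^sup>+e. v (f z e) \<partial>\<mu>) \<le> r * v z"
  shows "(\<integral>\<^sup>+\<omega>. v (recursion f z (\<lambda>i. \<eta> i \<omega>) n) \<partial>M) \<le> r ^ n * v z"
proof (induction n)
  case 0
  then show ?case by (simp add: emeasure_space_1)
next
  case (Suc n)
  define Z where "Z \<omega> = recursion f z (\<lambda>i. \<eta> i \<omega>) n" for \<omega>
  have Z [measurable]: "random_variable borel Z"
    unfolding Z_def by (rule recursion_random_variable[OF indep f])
  have ind: "indep_var borel Z borel (\<eta> (Suc n))"
    unfolding Z_def by (rule recursion_indep_next[OF indep f])
  then have [measurable]: "random_variable borel (\<eta> (Suc n))" by (rule indep_var_rv2)
  have joint: "distr M (borel \<Otimes>\<^sub>M borel) (\<lambda>\<omega>. (Z \<omega>, \<eta> (Suc n) \<omega>)) = distr M borel Z \<Otimes>\<^sub>M \<mu>"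
    using ind ident[of "Suc n"] by (simp add: indep_var_distribution_eq)
  interpret \<mu>: prob_space \<mu>
    using prob_space_distr[of "\<eta> (Suc n)" borel] ident[of "Suc n"] by simp
  have sets_\<mu> [measurable_cong]: "sets \<mu> = sets borel" using ident[of 1] by (metis order_refl sets_distr)
  have vf: "(\<lambda>(z, e). v (f z e)) \<in> borel_measurable (borel \<Otimes>\<^sub>M borel)"
    using measurable_compose[OF f v] by (simp add: case_prod_unfold)
  have "(\<integral>\<^sup>+\<omega>. v (recursion f z (\<lambda>i. \<eta> i \<omega>) (Suc n)) \<partial>M)
      = (\<integral>\<^sup>+\<omega>. (\<lambda>(z, e). v (f z e)) (Z \<omega>, \<eta> (Suc n) \<omega>) \<partial>M)"
    by (simp add: Z_def)
  also have "\<dots> = (\<integral>\<^sup>+q. (\<lambda>(z, e). v (f z e)) q \<partial>distr M (borel \<Otimes>\<^sub>M borel) (\<lambda>\<omega>. (Z \<omega>, \<eta> (Suc n) \<omega>)))"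
    using vf by (subst nn_integral_distr) auto
  also have "\<dots> = (\<integral>\<^sup>+z. (\<integral>\<^sup>+e. v (f z e) \<partial>\<mu>) \<partial>distr M borel Z)"
  proof -
    have "(\<lambda>(z, e). v (f z e)) \<in> borel_measurable (distr M borel Z \<Otimes>\<^sub>M \<mu>)"
      using vf by (simp cong: measurable_cong_sets add: sets_pair_measure_cong[OF sets_distr sets_\<mu>])
    from \<mu>.nn_integral_fst[OF this] show ?thesis by (simp add: joint)
  qed
  also have "\<dots> \<le> (\<integral>\<^sup>+z. r * v z \<partial>distr M borel Z)"
    by (intro nn_integral_mono drift)
  also have "\<dots> = r * (\<integral>\<^sup>+\<omega>. v (Z \<omega>) \<partial>M)"
    by (simp add: nn_integral_cmult nn_integral_distr)
  also have "\<dots> \<le> r * (r ^ n * v z)"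
    unfolding Z_def by (intro mult_left_mono Suc.IH) auto
  finally show ?case by (simp add: mult.assoc)
qed

section \<open>Exponential moments of first passage times\<close>

lemma first_passage_greater_iff:
  "enat n < first_passage X a \<omega> \<longleftrightarrow> (\<forall>k\<le>n. X k \<omega> \<le> a)"
proof
  assume less: "enat n < first_passage X a \<omega>"
  show "\<forall>k\<le>n. X k \<omega> \<le> a"
  proof (intro allI impI, rule ccontr)
    fix k assume k: "k \<le> n" "\<not> X k \<omega> \<le> a"
    then have "first_passage X a \<omega> \<le> enat k"
      unfolding first_passage_def by (intro Inf_lower) auto
    with less k show False by (metis enat_ord_simps(1) leD order_trans)
  qed
next
  assume le: "\<forall>k\<le>n. X k \<omega> \<le> a"
  have "enat (Suc n) \<le> first_passage X a \<omega>"
    unfolding first_passage_def using le by (intro Inf_greatest) (auto simp: not_less_eq_eq[symmetric] not_less)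
  then show "enat n < first_passage X a \<omega>" by (simp add: Suc_ile_eq)
qed

text \<open>A pathwise bound: for a finite \<open>t > 0\<close> the term of index \<open>t - 1\<close> alone is \<open>e\<^sup>\<alpha>\<^sup>t\<close>, and for
  \<open>t = \<infinity>\<close> the series diverges.\<close>

lemma exp_time_le_suminf:
  assumes "0 < \<alpha>"
  shows "exp_time \<alpha> t \<le> 1 + (\<Sum>n. ennreal (exp (\<alpha> * real (Suc n))) * indicator {n. enat n < t} n)"
proof (cases t)
  case (enat k)
  show ?thesis
  proof (cases k)
    case 0
    then show ?thesis by (simp add: enat exp_time_def)
  next
    case (Suc j)
    let ?g = "\<lambda>n. ennreal (exp (\<alpha> * real (Suc n))) * indicator {n. enat n < t} n"
    have "exp_time \<alpha> t = ?g j" by (simp add: enat exp_time_def Suc)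
    also have "\<dots> \<le> (\<Sum>n. ?g n)"
    proof -
      have "sum ?g {j} = ?g j" by (subst sum.insert) auto
      moreover have "sum ?g {j} \<le> (\<Sum>n. ?g n)" by (intro sum_le_suminf summableI) auto
      ultimately show ?thesis by simp
    qed
    finally show ?thesis by (simp add: add_increasing)
  qed
next
  case infinity
  have "(\<Sum>n. ennreal (exp (\<alpha> * real (Suc n)))) = \<top>"
  proof (rule ccontr)
    assume "(\<Sum>n. ennreal (exp (\<alpha> * real (Suc n)))) \<noteq> \<top>"
    then have "summable (\<lambda>n. exp (\<alpha> * real (Suc n)))" by (intro summable_suminf_not_top) auto
    then have "(\<lambda>n. exp (\<alpha> * real (Suc n))) \<longlonglongrightarrow> 0" by (rule summable_LIMSEQ_zero)
    then have "eventually (\<lambda>n. exp (\<alpha> * real (Suc n)) < 1) sequentially"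
      by (rule order_tendstoD) simp
    then obtain n where "exp (\<alpha> * real (Suc n)) < 1" by (auto simp: eventually_sequentially)
    then have "\<alpha> * real (Suc n) < 0" by simp
    with assms show False by (simp add: mult_less_0_iff)
  qed
  then show ?thesis by (simp add: infinity exp_time_def)
qed

text \<open>A geometric tail of a random time forces a finite exponential moment.  The time itself need not
  be measurable, only its tail events.\<close>

lemma (in prob_space) exp_moment_of_geometric_tail:
  fixes T :: "'a \<Rightarrow> enat" and C \<rho> :: real
  assumes [measurable]: "\<And>n. {\<omega> \<in> space M. enat n < T \<omega>} \<in> events"
    and tail: "\<And>n. emeasure M {\<omega> \<in> space M. enat n < T \<omega>} \<le> ennreal (C * \<rho> ^ n)"
    and \<rho>: "0 < \<rho>" "\<rho> < 1" and C: "0 \<le> C"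
  shows "\<exists>\<alpha>>0. (\<integral>\<^sup>+\<omega>. exp_time \<alpha> (T \<omega>) \<partial>M) < \<infinity>"
proof -
  \<comment> \<open>Then \<open>exp \<alpha> * \<rho> = sqrt \<rho> < 1\<close>.\<close>
  define \<alpha> where "\<alpha> = - ln \<rho> / 2"
  have \<alpha>: "0 < \<alpha>" using \<rho> by (simp add: \<alpha>_def)
  define q where "q = exp \<alpha> * \<rho>"
  have q: "0 < q" "q < 1"
  proof -
    have "q = exp (ln \<rho> / 2)"
      using \<rho> exp_add[of \<alpha> "ln \<rho>"] by (simp add: q_def \<alpha>_def)
    then show "0 < q" "q < 1" using \<rho> by auto
  qed
  let ?E = "\<lambda>n. {\<omega> \<in> space M. enat n < T \<omega>}"
  have "(\<integral>\<^sup>+\<omega>. exp_time \<alpha> (T \<omega>) \<partial>M)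
      \<le> (\<integral>\<^sup>+\<omega>. 1 + (\<Sum>n. ennreal (exp (\<alpha> * real (Suc n))) * indicator (?E n) \<omega>) \<partial>M)"
    using exp_time_le_suminf[OF \<alpha>]
    by (intro nn_integral_mono) (simp add: indicator_def)
  also have "\<dots> = 1 + (\<Sum>n. ennreal (exp (\<alpha> * real (Suc n))) * emeasure M (?E n))"
    by (simp add: nn_integral_add nn_integral_suminf nn_integral_cmult_indicator emeasure_space_1)
  also have "\<dots> \<le> 1 + (\<Sum>n. ennreal (exp \<alpha> * C * q ^ n))"
  proof (intro add_left_mono suminf_le summableI)
    fix n
    have "ennreal (exp (\<alpha> * real (Suc n))) * emeasure M (?E n)
        \<le> ennreal (exp (\<alpha> * real (Suc n))) * ennreal (C * \<rho> ^ n)"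
      by (intro mult_left_mono tail) auto
    also have "\<dots> = ennreal (exp (\<alpha> * real (Suc n)) * (C * \<rho> ^ n))"
      using C \<rho> by (subst ennreal_mult) auto
    also have "exp (\<alpha> * real (Suc n)) * (C * \<rho> ^ n) = exp \<alpha> * C * q ^ n"
      by (simp add: q_def power_mult_distrib exp_of_nat2_mult distrib_left exp_add)
    finally show "ennreal (exp (\<alpha> * real (Suc n))) * emeasure M (?E n) \<le> ennreal (exp \<alpha> * C * q ^ n)" .
  qed
  also have "\<dots> < \<infinity>"
  proof -
    have "summable (\<lambda>n. exp \<alpha> * C * q ^ n)" using q by (intro summable_mult summable_geometric) auto
    then have "(\<Sum>n. ennreal (exp \<alpha> * C * q ^ n)) \<noteq> \<top>"
      using C q by (intro ennreal_suminf_neq_top) auto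
    then show ?thesis by (simp add: less_top)
  qed
  finally show ?thesis using \<alpha> by blast
qed

section \<open>The first passage time of the autoregression\<close>

text \<open>One step of the autoregression frozen at its first value above \<open>a\<close>.\<close>

definition stopped_step :: "real \<Rightarrow> real \<Rightarrow> real \<Rightarrow> real \<Rightarrow> real" where
  "stopped_step lam a z e = (if z \<le> a then lam * z + e else z)"

lemma stopped_step_measurable:
  "(\<lambda>(z, e). stopped_step lam a z e) \<in> borel_measurable (borel \<Otimes>\<^sub>M borel)"
  unfolding stopped_step_def case_prod_unfold by measurable

lemma stopped_recursion_eq_ar1:
  assumes "\<And>k. k < n \<Longrightarrow> ar1 lam x \<eta> k \<omega> \<le> a"
  shows "recursion (stopped_step lam a) x (\<lambda>i. \<eta> i \<omega>) n = ar1 lam x \<eta> n \<omega>"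
  using assms by (induction n) (auto simp: stopped_step_def)

lemma stopped_recursion_le_iff:
  "recursion (stopped_step lam a) x (\<lambda>i. \<eta> i \<omega>) n \<le> a \<longleftrightarrow> (\<forall>k\<le>n. ar1 lam x \<eta> k \<omega> \<le> a)"
proof (induction n)
  case (Suc n)
  let ?Z = "recursion (stopped_step lam a) x (\<lambda>i. \<eta> i \<omega>)"
  show ?case
  proof (cases "\<forall>k\<le>n. ar1 lam x \<eta> k \<omega> \<le> a")
    case True
    then have "?Z (Suc n) = ar1 lam x \<eta> (Suc n) \<omega>"
      by (intro stopped_recursion_eq_ar1) auto
    with True show ?thesis by (auto simp only: le_Suc_eq)
  next
    case False
    with Suc.IH have "\<not> ?Z n \<le> a" by simp
    then have "\<not> ?Z (Suc n) \<le> a" by (simp add: stopped_step_def)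
    with False show ?thesis by (meson le_SucI)
  qed
qed simp

theorem theorem1:
  fixes M :: "'a measure" and \<eta> :: "nat \<Rightarrow> 'a \<Rightarrow> real" and lam x a \<delta> :: real
  assumes "prob_space M"
    and indep: "prob_space.indep_vars M (\<lambda>_. borel) \<eta> {1..}"
    and ident: "\<And>n. n \<ge> 1 \<Longrightarrow> distr M borel (\<eta> n) = distr M borel (\<eta> 1)"
    and "0 < lam" and "lam < 1"
    and "x \<le> a" and "0 < a"
    and "measure M {\<omega> \<in> space M. \<eta> 1 \<omega> > a * (1 - lam)} > 0"
    and "0 < \<delta>" and "\<delta> < 1"
    and "(\<integral>\<^sup>+\<omega>. ennreal (neg_part (\<eta> 1 \<omega>) powr \<delta>) \<partial>M) < \<infinity>"
  shows "\<exists>\<alpha>>0. (\<integral>\<^sup>+\<omega>. exp_time \<alpha> (first_passage (ar1 lam x \<eta>) a \<omega>) \<partial>M) < \<infinity>"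
proof -
  interpret prob_space M by fact
  define \<mu> where "\<mu> = distr M borel (\<eta> 1)"
  have \<eta>1 [measurable]: "random_variable borel (\<eta> 1)"
    using indep unfolding indep_vars_def by (meson atLeast_iff order_refl)
  have prob_\<mu>: "prob_space \<mu>" unfolding \<mu>_def by (rule prob_space_distr[OF \<eta>1])
  have sets_\<mu>: "sets \<mu> = sets borel" by (simp add: \<mu>_def)
  have "measure \<mu> {a * (1 - lam)<..} = measure M (\<eta> 1 -` {a * (1 - lam)<..} \<inter> space M)"
    unfolding \<mu>_def by (rule measure_distr[OF \<eta>1]) simp
  also have "\<eta> 1 -` {a * (1 - lam)<..} \<inter> space M = {\<omega> \<in> space M. \<eta> 1 \<omega> > a * (1 - lam)}" by auto
  finally have pos: "measure \<mu> {a * (1 - lam)<..} > 0" using assms by simp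
  have int: "integrable \<mu> (\<lambda>e. neg_part e powr \<delta>)"
    unfolding integrable_iff_bounded
  proof
    have "(\<integral>\<^sup>+e. ennreal (norm (neg_part e powr \<delta>)) \<partial>\<mu>)
        = (\<integral>\<^sup>+\<omega>. ennreal (norm (neg_part (\<eta> 1 \<omega>) powr \<delta>)) \<partial>M)"
      unfolding \<mu>_def
      by (rule nn_integral_distr[OF \<eta>1, where f = "\<lambda>e. ennreal (norm (neg_part e powr \<delta>))"]) simp
    then show "(\<integral>\<^sup>+e. ennreal (norm (neg_part e powr \<delta>)) \<partial>\<mu>) < \<infinity>" using assms(11) by simp
    show "(\<lambda>e. neg_part e powr \<delta>) \<in> borel_measurable \<mu>" unfolding \<mu>_def by measurable
  qed
  obtain v \<rho> where v [measurable]: "v \<in> borel_measurable borel"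
    and \<rho>: "0 < \<rho>" "\<rho> < 1" and v_ge: "\<And>z. z \<le> a \<Longrightarrow> 1 \<le> v z"
    and drift: "\<And>z. z \<le> a \<Longrightarrow>
       (\<integral>\<^sup>+e. ennreal (if lam * z + e \<le> a then v (lam * z + e) else 0) \<partial>\<mu>) \<le> ennreal (\<rho> * v z)"
    by (rule lyapunov_function[OF prob_\<mu> sets_\<mu> assms(4,5,7) pos assms(9,10) int])
      (rule that)
  define V where "V z = ennreal (if z \<le> a then v z else 0)" for z
  have V [measurable]: "V \<in> borel_measurable borel" unfolding V_def by measurable
  have V_drift: "(\<integral>\<^sup>+e. V (stopped_step lam a z e) \<partial>\<mu>) \<le> ennreal \<rho> * V z" for z
  proof (cases "z \<le> a")
    case True
    then show ?thesis
      using drift[OF True] \<rho> v_ge[OF True] by (simp add: V_def stopped_step_def ennreal_mult')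
  qed (simp add: V_def stopped_step_def)
  define Z where "Z n \<omega> = recursion (stopped_step lam a) x (\<lambda>i. \<eta> i \<omega>) n" for n \<omega>
  have Z [measurable]: "random_variable borel (Z n)" for n
    unfolding Z_def by (rule recursion_random_variable[OF indep stopped_step_measurable])
  have passage: "enat n < first_passage (ar1 lam x \<eta>) a \<omega> \<longleftrightarrow> Z n \<omega> \<le> a" for n \<omega>
    by (simp add: first_passage_greater_iff Z_def stopped_recursion_le_iff)
  have tail: "emeasure M {\<omega> \<in> space M. Z n \<omega> \<le> a} \<le> ennreal (v x * \<rho> ^ n)" for n
  proof -
    have "emeasure M {\<omega> \<in> space M. Z n \<omega> \<le> a} = (\<integral>\<^sup>+\<omega>. indicator {\<omega> \<in> space M. Z n \<omega> \<le> a} \<omega> \<partial>M)"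
      by simp
    also have "\<dots> \<le> (\<integral>\<^sup>+\<omega>. V (Z n \<omega>) \<partial>M)"
      using v_ge by (intro nn_integral_mono) (auto simp: V_def indicator_def)
    also have "\<dots> \<le> ennreal \<rho> ^ n * V x"
      unfolding Z_def
      by (rule recursion_geometric_drift[OF indep ident[folded \<mu>_def] stopped_step_measurable V V_drift])
    also have "\<dots> = ennreal (v x * \<rho> ^ n)"
      using \<rho> v_ge[OF \<open>x \<le> a\<close>] \<open>x \<le> a\<close>
      by (simp add: V_def ennreal_power ennreal_mult'[symmetric] mult.commute)
    finally show ?thesis .
  qed
  show ?thesis
  proof (rule exp_moment_of_geometric_tail)
    show "{\<omega> \<in> space M. enat n < first_passage (ar1 lam x \<eta>) a \<omega>} \<in> events" for n
      unfolding passage by measurable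
    show "emeasure M {\<omega> \<in> space M. enat n < first_passage (ar1 lam x \<eta>) a \<omega>}
        \<le> ennreal (v x * \<rho> ^ n)" for n
      unfolding passage by (rule tail)
    show "0 < \<rho>" "\<rho> < 1" by fact+
    show "0 \<le> v x" using v_ge[OF \<open>x \<le> a\<close>] by simp
  qed
qed

end
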